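(* Let $\dot{x}=F(x)$ be an ODE on $M\subset\mathbb{R}^d$ with flow $\varrho_r(x_0)$, and consider the Koopman eigenfunction PDE $F(x)\cdot\nabla\phi_\lambda(x)=\lambda\phi_\lambda(x)$. Let $\Lambda\subset M$ be a closed co-dimension-one (initial data) manifold that is transverse to the flow and nonrecurrent for a time epoch $r\in[t_1,t_2]$ containing $0$, and let $U=\bigcup_{t\in[t_1,t_2]}\varrho_t(\Lambda)$ be the resulting nonrecurrent closed domain. Let $h:\Lambda\to\mathbb{C}$ be a $C^1(\Lambda)$ initial data function, and let $\lambda\in\mathbb{C}$. Then the open-KEIGS pair $(\lambda,\phi_\lambda)$, $\phi_\lambda:U\to\mathbb{C}$, with initial data $h$ on $\Lambda$ has the form $$\phi_\lambda(x)=\big(h\circ s^*(x)\big)\,e^{\lambda r^*(x)},\qquad x\in U,$$ where $r^*(x)$ is the time of flight, i.e. the $r$ such that $\varrho_{-r}(x)\in\Lambda$ (intersection in $U$ by pull back to $\Lambda$), and $s^*(x)=s\circ\varrho_{-r^*(x)}(x)$ is the parameter value on $\Lambda$ of the pulled back point, $s$ being the parameterization on $\Lambda$.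
   Context: $F:M\to\mathbb{R}^d$ is a vector field regular enough (e.g. Lipschitz) for existence and uniqueness of solutions; $\varrho_t(x_0)$ denotes the solution at time $t$ with initial value $x_0$. The Koopman operator acts on observables $g:M\to\mathbb{C}$ by $\mathscr{K}_t[g]=g\circ\varrho_t$. A KEIGS is a pair $(\lambda,\phi_\lambda)$ with $\lambda\in\mathbb{C}$ and $\phi_\lambda$ satisfying $\mathscr{K}_t[\phi_\lambda](x)=\phi_\lambda(\varrho_t(x))=e^{\lambda t}\phi_\lambda(x)$. An open-KEIGS (open eigenfunction) on a domain $U$ is a pair for which this relation is required for those $x,t$ such that both $x$ and $\varrho_t(x)$ lie in $U$. Nonrecurrence (of $\Lambda$ over the epoch, and of the resulting $U$) means that there are no loops in $U$, such as periodic orbits, and no orbit segments that exit $U$ and re-enter it, nor any returns to $\Lambda$; in particular each $x\in U$ has a unique $r\in[t_1,t_2]$ with $\varrho_{-r}(x)\in\Lambda$. "Initial data $h$ on $\Lambda$" means $\phi_\lambda=h$ on $\Lambda$. Points $y\in\Lambda$ are identified with their parameter $s(y)$, so $h$ is regarded as a function of $s$. *)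

theory Defs
  imports "HOL-Analysis.Analysis"
begin

definition ode_solution ::
  "('a::euclidean_space \<Rightarrow> 'a) \<Rightarrow> 'a set \<Rightarrow> 'a \<Rightarrow> real set \<Rightarrow> (real \<Rightarrow> 'a) \<Rightarrow> bool" where
  "ode_solution F M x0 I u \<longleftrightarrow>
     is_interval I \<and> 0 \<in> I \<and> u 0 = x0 \<and>
     (\<forall>t\<in>I. u t \<in> M \<and> (u has_vector_derivative F (u t)) (at t within I))"

text \<open>Local existence and uniqueness. The interval of existence may lie on one side of 0 only,
  so that \<open>M\<close> is allowed to have boundary points.\<close>

definition well_posed :: "('a::euclidean_space \<Rightarrow> 'a) \<Rightarrow> 'a set \<Rightarrow> bool" where
  "well_posed F M \<longleftrightarrow>
     (\<forall>x0\<in>M. \<exists>I u. ode_solution F M x0 I u \<and> I \<noteq> {0}) \<and>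
     (\<forall>x0\<in>M. \<forall>I J u v. ode_solution F M x0 I u \<longrightarrow> ode_solution F M x0 J v \<longrightarrow>
        (\<forall>t\<in>I \<inter> J. u t = v t))"

definition existence_interval :: "('a::euclidean_space \<Rightarrow> 'a) \<Rightarrow> 'a set \<Rightarrow> 'a \<Rightarrow> real set" where
  "existence_interval F M x0 = \<Union>{I. \<exists>u. ode_solution F M x0 I u}"

text \<open>Solutions need not be global: \<open>flow F M t x0\<close> is meaningful only for
  \<open>t \<in> existence_interval F M x0\<close>, and every statement below is guarded accordingly.\<close>

definition flow :: "('a::euclidean_space \<Rightarrow> 'a) \<Rightarrow> 'a set \<Rightarrow> real \<Rightarrow> 'a \<Rightarrow> 'a" where
  "flow F M t x0 = (THE y. \<exists>I u. ode_solution F M x0 I u \<and> t \<in> I \<and> y = u t)"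

definition koopman ::
  "('a::euclidean_space \<Rightarrow> 'a) \<Rightarrow> 'a set \<Rightarrow> real \<Rightarrow> ('a \<Rightarrow> complex) \<Rightarrow> 'a \<Rightarrow> complex" where
  "koopman F M t g = g \<circ> flow F M t"

definition open_KEIGS ::
  "('a::euclidean_space \<Rightarrow> 'a) \<Rightarrow> 'a set \<Rightarrow> 'a set \<Rightarrow> complex \<Rightarrow> ('a \<Rightarrow> complex) \<Rightarrow> bool" where
  "open_KEIGS F M U lam \<phi> \<longleftrightarrow>
     (\<forall>x\<in>U. \<forall>t\<in>existence_interval F M x. flow F M t x \<in> U \<longrightarrow>
        koopman F M t \<phi> x = exp (lam * of_real t) * \<phi> x)"

text \<open>The equation \<open>F(x) \<bullet> \<nabla>\<phi>(x) = lam \<phi>(x)\<close> at one point.\<close>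

definition koopman_pde_at ::
  "('a::euclidean_space \<Rightarrow> 'a) \<Rightarrow> complex \<Rightarrow> ('a \<Rightarrow> complex) \<Rightarrow> 'a \<Rightarrow> bool" where
  "koopman_pde_at F lam \<phi> x \<longleftrightarrow>
     (\<exists>D. (\<phi> has_derivative D) (at x) \<and> D (F x) = lam * \<phi> x)"

text \<open>Intended for open \<open>V\<close>.\<close>

definition C1_on :: "'a::euclidean_space set \<Rightarrow> ('a \<Rightarrow> 'b::real_normed_vector) \<Rightarrow> bool" where
  "C1_on V f \<longleftrightarrow>
     (\<exists>f'. (\<forall>x\<in>V. (f has_derivative blinfun_apply (f' x)) (at x)) \<and> continuous_on V f')"

text \<open>Embedded \<open>C\<^sup>1\<close> hypersurface, possibly with boundary, given by slice charts: a local \<open>C\<^sup>1\<close>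
  diffeomorphism of the ambient space straightens \<open>\<Lambda>\<close> to a hyperplane (\<open>f = 0\<close>) or to a half
  hyperplane (\<open>f \<noteq> 0\<close>).\<close>

definition C1_hypersurface :: "'a::euclidean_space set \<Rightarrow> bool" where
  "C1_hypersurface \<Lambda> \<longleftrightarrow>
     (\<forall>p\<in>\<Lambda>. \<exists>V (\<Phi> :: 'a \<Rightarrow> 'a) e f.
        open V \<and> p \<in> V \<and> open (\<Phi> ` V) \<and> inj_on \<Phi> V \<and>
        C1_on V \<Phi> \<and> C1_on (\<Phi> ` V) (the_inv_into V \<Phi>) \<and>
        e \<noteq> 0 \<and> e \<bullet> f = 0 \<and>
        \<Phi> ` (\<Lambda> \<inter> V) = \<Phi> ` V \<inter> {w. w \<bullet> e = 0 \<and> w \<bullet> f \<ge> 0})"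

text \<open>Velocities of one-sided curves are used, and their span taken, in order to obtain the full
  tangent space at boundary points as well.\<close>

definition tangent_space :: "'a::euclidean_space set \<Rightarrow> 'a \<Rightarrow> 'a set" where
  "tangent_space \<Lambda> p = span {v. \<exists>\<gamma> \<epsilon>. \<epsilon> > 0 \<and> \<gamma> ` {0..<\<epsilon>} \<subseteq> \<Lambda> \<and> \<gamma> 0 = p \<and>
     (\<gamma> has_vector_derivative v) (at (0::real) within {0..<\<epsilon>})}"

definition transverse :: "('a::euclidean_space \<Rightarrow> 'a) \<Rightarrow> 'a set \<Rightarrow> bool" where
  "transverse F \<Lambda> \<longleftrightarrow> (\<forall>p\<in>\<Lambda>. F p \<notin> tangent_space \<Lambda> p)"

text \<open>A function on \<open>\<Lambda>\<close> is \<open>C\<^sup>1\<close> if it locally extends to a \<open>C\<^sup>1\<close> function on the ambient space.\<close>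

definition C1_on_hypersurface ::
  "'a::euclidean_space set \<Rightarrow> ('a \<Rightarrow> 'b::real_normed_vector) \<Rightarrow> bool" where
  "C1_on_hypersurface \<Lambda> h \<longleftrightarrow>
     (\<forall>p\<in>\<Lambda>. \<exists>V g. open V \<and> p \<in> V \<and> C1_on V g \<and> (\<forall>y\<in>\<Lambda> \<inter> V. g y = h y))"

definition flow_domain ::
  "('a::euclidean_space \<Rightarrow> 'a) \<Rightarrow> 'a set \<Rightarrow> 'a set \<Rightarrow> real \<Rightarrow> real \<Rightarrow> 'a set" where
  "flow_domain F M \<Lambda> t1 t2 = (\<Union>t\<in>{t1..t2}. flow F M t ` \<Lambda>)"

text \<open>No loops in \<open>U\<close>, no orbit segment that leaves \<open>U\<close> and enters it again, no returns to \<open>\<Lambda>\<close>.\<close>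

definition nonrecurrent ::
  "('a::euclidean_space \<Rightarrow> 'a) \<Rightarrow> 'a set \<Rightarrow> 'a set \<Rightarrow> real \<Rightarrow> real \<Rightarrow> bool" where
  "nonrecurrent F M \<Lambda> t1 t2 \<longleftrightarrow>
     (let U = flow_domain F M \<Lambda> t1 t2 in
       (\<forall>x\<in>U. \<forall>t\<in>existence_interval F M x. t \<noteq> 0 \<longrightarrow> flow F M t x \<noteq> x) \<and>
       (\<forall>x\<in>U. \<forall>t\<in>existence_interval F M x. flow F M t x \<in> U \<longrightarrow>
          (\<forall>r\<in>closed_segment 0 t. flow F M r x \<in> U)) \<and>
       (\<forall>y\<in>\<Lambda>. \<forall>t\<in>existence_interval F M y. t \<noteq> 0 \<longrightarrow> flow F M t y \<notin> \<Lambda>))"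

definition is_flight_time ::
  "('a::euclidean_space \<Rightarrow> 'a) \<Rightarrow> 'a set \<Rightarrow> 'a set \<Rightarrow> real \<Rightarrow> real \<Rightarrow> 'a \<Rightarrow> real \<Rightarrow> bool" where
  "is_flight_time F M \<Lambda> t1 t2 x r \<longleftrightarrow>
     r \<in> {t1..t2} \<and> - r \<in> existence_interval F M x \<and> flow F M (- r) x \<in> \<Lambda>"

definition r_star ::
  "('a::euclidean_space \<Rightarrow> 'a) \<Rightarrow> 'a set \<Rightarrow> 'a set \<Rightarrow> real \<Rightarrow> real \<Rightarrow> 'a \<Rightarrow> real" where
  "r_star F M \<Lambda> t1 t2 x = (THE r. is_flight_time F M \<Lambda> t1 t2 x r)"

definition s_star ::
  "('a::euclidean_space \<Rightarrow> 'a) \<Rightarrow> 'a set \<Rightarrow> 'a set \<Rightarrow> real \<Rightarrow> real \<Rightarrow> ('a \<Rightarrow> 'p) \<Rightarrow> 'a \<Rightarrow> 'p" where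
  "s_star F M \<Lambda> t1 t2 s x = s (flow F M (- r_star F M \<Lambda> t1 t2 x) x)"

text \<open>A function on \<open>\<Lambda>\<close> regarded as a function of the parameter \<open>s\<close>. Of a parameterization only the
  injectivity on \<open>\<Lambda>\<close> is used; requiring a single continuous chart would exclude spheres.\<close>

definition in_parameter :: "('a \<Rightarrow> 'p) \<Rightarrow> 'a set \<Rightarrow> ('a \<Rightarrow> 'b) \<Rightarrow> 'p \<Rightarrow> 'b" where
  "in_parameter s \<Lambda> h = h \<circ> the_inv_into \<Lambda> s"

end

theory Submission imports Defs begin

text \<open>The eigenfunction relation \<open>\<phi> (\<rho>\<^sub>t x) = e\<^bsup>\<lambda>t\<^esup> \<phi> x\<close> determines \<open>\<phi>\<close> along an
  orbit from its value at one point of that orbit. Nonrecurrence makes \<open>\<Lambda>\<close> a cross-section: every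
  orbit piece in \<open>U\<close> meets \<open>\<Lambda>\<close> exactly once, at the signed time of flight. Hence the values of \<open>\<phi>\<close>
  on \<open>\<Lambda>\<close> can be prescribed freely and fix \<open>\<phi>\<close> on \<open>U\<close>: pull \<open>x\<close> back to \<open>\<Lambda>\<close> in time \<open>r\<^sup>* x\<close>, read
  off \<open>h\<close> there, and multiply by \<open>e\<^bsup>\<lambda> r\<^sup>*\<^esup>\<close> on the way forward. Conversely the formula
  satisfies the relation because \<open>r\<^sup>*\<close> increases by exactly \<open>t\<close> along an orbit segment of duration \<open>t\<close>
  while the foot point on \<open>\<Lambda>\<close> stays the same.

  All of this rests on the group law for a flow that is only locally defined. It comes from one fact,
  \<open>maximal_solution\<close>: the flow restricted to its existence interval is itself a solution. Translating
  this solution in time shows that existence intervals along an orbit are translates of one another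
  (\<open>flow_flow\<close>), so that any point of an orbit can serve as its initial point.

  The differential equation is the derivative at \<open>t = 0\<close> of the eigenfunction relation. Since the
  solution through a boundary point of \<open>M\<close> may exist in one time direction only, this derivative
  is taken within the existence interval (\<open>open_KEIGS_imp_koopman_pde_at\<close>).\<close>

section \<open>The maximal solution and the local group law\<close>

lemma ode_solution_shift:
  assumes u: "ode_solution F M x I u" and s: "s \<in> I"
  shows "ode_solution F M (u s) {t. s + t \<in> I} (\<lambda>t. u (s + t))"
proof -
  have img: "(+) s ` {t. s + t \<in> I} = I"
    using image_vimage_eq[of "(+) s" I] by (simp add: vimage_def surj_plus)
  have "((\<lambda>t. u (s + t)) has_vector_derivative F (u (s + t))) (at t within {t. s + t \<in> I})"
    if "s + t \<in> I" for t
  proof -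
    have "((+) s has_vector_derivative 1) (at t within {t. s + t \<in> I})"
      by (auto intro!: derivative_eq_intros)
    moreover have "(u has_vector_derivative F (u (s + t))) (at (s + t) within (+) s ` {t. s + t \<in> I})"
      unfolding img using u that by (auto simp: ode_solution_def)
    ultimately show ?thesis
      using vector_diff_chain_within[of "(+) s" 1 t "{t. s + t \<in> I}" u] by (simp add: o_def)
  qed
  moreover have "is_interval {t. s + t \<in> I}"
    unfolding is_interval_1
  proof (intro ballI allI impI)
    fix a b c assume "a \<in> {t. s + t \<in> I}" "b \<in> {t. s + t \<in> I}" "a \<le> c \<and> c \<le> b"
    then show "c \<in> {t. s + t \<in> I}"
      using u mem_is_interval_1_I[of I "s + a" "s + b" "s + c"] by (auto simp: ode_solution_def)
  qed
  ultimately show ?thesis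
    using u s by (auto simp: ode_solution_def)
qed

lemma flow_eq_solution:
  assumes "well_posed F M" "x \<in> M" "ode_solution F M x I u" "t \<in> I"
  shows "flow F M t x = u t"
  unfolding flow_def
proof (rule the_equality)
  show "\<exists>I' u'. ode_solution F M x I' u' \<and> t \<in> I' \<and> u t = u' t"
    using assms by blast
  show "y = u t" if "\<exists>I' u'. ode_solution F M x I' u' \<and> t \<in> I' \<and> y = u' t" for y
    using that assms unfolding well_posed_def by (metis IntI)
qed

lemma mem_existence_intervalI:
  "ode_solution F M x I u \<Longrightarrow> t \<in> I \<Longrightarrow> t \<in> existence_interval F M x"
  by (auto simp: existence_interval_def)

lemma mem_existence_intervalE:
  assumes "t \<in> existence_interval F M x"
  obtains I u where "ode_solution F M x I u" "t \<in> I"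
  using assms by (auto simp: existence_interval_def)

text \<open>Two times in the existence interval need not belong to one solution yet, for instance when
  they lie on different sides of 0. But some solution defined at \<open>t\<close> always goes some way
  towards \<open>t'\<close>, and this is what a one-sided derivative at \<open>t\<close> needs.\<close>

lemma solution_towards:
  assumes "t \<in> existence_interval F M x" "t' \<in> existence_interval F M x" "t \<noteq> t'"
  obtains I u c where "ode_solution F M x I u" "t \<in> I" "c \<in> I" "c \<noteq> t" "c \<in> closed_segment t t'"
proof -
  obtain I u where I: "ode_solution F M x I u" "t \<in> I"
    using assms(1) by (rule mem_existence_intervalE)
  obtain J v where J: "ode_solution F M x J v" "t' \<in> J"
    using assms(2) by (rule mem_existence_intervalE)
  have int: "is_interval I" "is_interval J" "0 \<in> I" "0 \<in> J"
    using I J by (auto simp: ode_solution_def)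
  consider "t' \<in> I" | "t \<in> J" | "t' \<notin> I" "t \<notin> J" by blast
  then show ?thesis
  proof cases
    case 1
    show ?thesis by (rule that[OF I 1]) (use assms(3) in auto)
  next
    case 2
    show ?thesis by (rule that[OF J(1) 2 J(2)]) (use assms(3) in auto)
  next
    case 3
    \<comment> \<open>Neither solution reaches the other time, so 0 separates the two times.\<close>
    have "t \<noteq> 0" using 3 int by auto
    moreover have "\<not> (0 \<le> t \<and> t \<le> t')" "\<not> (t' \<le> t \<and> t \<le> 0)"
      using 3 int J(2) mem_is_interval_1_I by blast+
    moreover have "\<not> (0 \<le> t' \<and> t' \<le> t)" "\<not> (t \<le> t' \<and> t' \<le> 0)"
      using 3 int I(2) mem_is_interval_1_I by blast+
    ultimately have "t \<noteq> 0" "0 \<in> closed_segment t t'"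
      by (auto simp: closed_segment_eq_real_ivl)
    then show ?thesis
      using that[OF I int(3)] by auto
  qed
qed

text \<open>By uniqueness all solutions through \<open>x\<close> are restrictions of the flow, so the flow has one-sided
  derivatives in both directions in which it can be continued. Gluing them matters at time 0, where
  the existence interval can be two-sided although each single solution is one-sided, and at other
  times where one solution ends and another one continues.\<close>

lemma maximal_solution:
  assumes wp: "well_posed F M" and x: "x \<in> M"
  shows "ode_solution F M x (existence_interval F M x) (\<lambda>t. flow F M t x)"
proof -
  let ?E = "existence_interval F M x" and ?u = "\<lambda>t. flow F M t x"
  have zero: "0 \<in> ?E" and val: "?u 0 = x"
  proof -
    have "ode_solution F M x {0} (\<lambda>_. x)"
      using x by (auto simp: ode_solution_def is_interval_1 has_vector_derivative_def
          has_derivative_within_singleton_iff bounded_linear_scaleR_left)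
    then show "0 \<in> ?E" "?u 0 = x"
      using flow_eq_solution[OF wp x] mem_existence_intervalI by fastforce+
  qed
  have sol_int: "is_interval I \<and> 0 \<in> I" if "ode_solution F M x I u" for I u
    using that by (auto simp: ode_solution_def)
  have int: "is_interval ?E"
    unfolding is_interval_1
  proof (intro ballI allI impI)
    fix a b c assume a: "a \<in> ?E" and b: "b \<in> ?E" and c: "a \<le> c \<and> c \<le> b"
    obtain I u where I: "ode_solution F M x I u" "a \<in> I"
      using a by (rule mem_existence_intervalE)
    obtain J v where J: "ode_solution F M x J v" "b \<in> J"
      using b by (rule mem_existence_intervalE)
    have "c \<in> I \<or> c \<in> J"
      using c I(2) J(2) sol_int[OF I(1)] sol_int[OF J(1)]
      by (meson linear mem_is_interval_1_I)
    then show "c \<in> ?E"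
      using I J mem_existence_intervalI by blast
  qed
  have inM: "?u t \<in> M" if "t \<in> ?E" for t
    using that
  proof (rule mem_existence_intervalE)
    fix I u assume "ode_solution F M x I u" "t \<in> I"
    then show ?thesis
      using flow_eq_solution[OF wp x] by (auto simp: ode_solution_def)
  qed
  have side: "(?u has_vector_derivative F (?u t)) (at t within closed_segment t t')"
    if t: "t \<in> ?E" "t' \<in> ?E" for t t'
  proof (cases "t = t'")
    case True
    then show ?thesis
      by (simp add: has_vector_derivative_def has_derivative_within_singleton_iff
          bounded_linear_scaleR_left)
  next
    case False
    obtain I u c where I: "ode_solution F M x I u" "t \<in> I" "c \<in> I" and
      c: "c \<noteq> t" "c \<in> closed_segment t t'"
      using solution_towards[OF t False] .
    have sub: "closed_segment t c \<subseteq> I"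
      using I sol_int[OF I(1)] by (simp add: closed_segment_subset is_interval_convex)
    have eq: "?u r = u r" if "r \<in> I" for r
      using flow_eq_solution[OF wp x I(1) that] .
    have "(u has_vector_derivative F (u t)) (at t within closed_segment t c)"
      using I sub by (auto simp: ode_solution_def intro: has_vector_derivative_within_subset)
    then have "(?u has_vector_derivative F (?u t)) (at t within closed_segment t c)"
      unfolding eq[OF I(2)]
      by (rule has_vector_derivative_transform[rotated 2]) (use sub eq in auto)
    moreover have "at t within closed_segment t c = at t within closed_segment t t'"
    proof (rule at_within_nhd[where S="ball t \<bar>c - t\<bar>"])
      show "closed_segment t c \<inter> ball t \<bar>c - t\<bar> - {t} = closed_segment t t' \<inter> ball t \<bar>c - t\<bar> - {t}"
        using c by (auto simp: closed_segment_eq_real_ivl dist_real_def split: if_splits)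
    qed (use c in auto)
    ultimately show ?thesis by simp
  qed
  have "(?u has_vector_derivative F (?u t)) (at t within ?E)" if t: "t \<in> ?E" for t
  proof -
    \<comment> \<open>Near \<open>t\<close> the existence interval is the union of two segments ending in points \<open>a\<close>, \<open>b\<close> of it;
      a segment degenerates to \<open>{t}\<close> when \<open>t\<close> is an endpoint of the existence interval.\<close>
    obtain a where a: "a \<in> ?E" "a \<le> t" "a < t \<or> (\<forall>r\<in>?E. t \<le> r)"
      using t by (meson linorder_not_le order_less_imp_le order_refl)
    obtain b where b: "b \<in> ?E" "t \<le> b" "t < b \<or> (\<forall>r\<in>?E. r \<le> t)"
      using t by (meson linorder_not_le order_less_imp_le order_refl)
    define lo where "lo = (if a < t then a else t - 1)"
    define hi where "hi = (if t < b then b else t + 1)"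
    have "at t within ?E = at t within closed_segment t a \<union> closed_segment t b"
    proof (rule at_within_nhd[where S="{lo<..<hi}"])
      show "?E \<inter> {lo<..<hi} - {t} = (closed_segment t a \<union> closed_segment t b) \<inter> {lo<..<hi} - {t}"
      proof -
        have "closed_segment t a \<union> closed_segment t b = {a..b}"
          using a(2) b(2) by (auto simp: closed_segment_eq_real_ivl)
        moreover have "{a..b} \<subseteq> ?E"
          using mem_is_interval_1_I[OF int a(1) b(1)] by auto
        moreover have "r \<in> {a..b}" if "r \<in> ?E" "lo < r" "r < hi" for r
        proof -
          have "a \<le> r"
            using a that by (cases "a < t") (auto simp: lo_def)
          moreover have "r \<le> b"
            using b that by (cases "t < b") (auto simp: hi_def)
          ultimately show ?thesis by simp
        qed
        ultimately show ?thesis by auto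
      qed
    qed (use a b in \<open>auto simp: lo_def hi_def\<close>)
    moreover have "(?u has_vector_derivative F (?u t))
        (at t within closed_segment t a \<union> closed_segment t b)"
      using side[OF t a(1)] side[OF t b(1)]
      unfolding has_vector_derivative_def has_derivative_within
      by (simp add: at_within_union filterlim_sup)
    ultimately show ?thesis by (simp only:)
  qed
  then show ?thesis
    using int zero val inM by (simp add: ode_solution_def)
qed

lemma zero_mem_existence_interval:
  assumes "well_posed F M" "x \<in> M"
  shows "0 \<in> existence_interval F M x"
  using maximal_solution[OF assms] by (simp add: ode_solution_def)

lemma flow_0 [simp]:
  assumes "well_posed F M" "x \<in> M"
  shows "flow F M 0 x = x"
  using maximal_solution[OF assms] by (simp add: ode_solution_def)

lemma flow_mem:
  assumes "well_posed F M" "x \<in> M" "t \<in> existence_interval F M x"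
  shows "flow F M t x \<in> M"
  using maximal_solution[OF assms(1,2)] assms(3) by (simp add: ode_solution_def)

text \<open>The maximal solution through \<open>x\<close>, translated by \<open>s\<close>, is a solution through \<open>\<rho>\<^sub>s x\<close>. Because it is
  defined at time \<open>-s\<close>, where it returns to \<open>x\<close>, the roles of the two points can be exchanged,
  and the inclusion of existence intervals becomes an equality.\<close>

lemma flow_flow:
  assumes wp: "well_posed F M" and x: "x \<in> M" and s: "s \<in> existence_interval F M x"
  shows existence_interval_flow:
      "t \<in> existence_interval F M (flow F M s x) \<longleftrightarrow> s + t \<in> existence_interval F M x"
    and flow_add: "s + t \<in> existence_interval F M x \<Longrightarrow>
      flow F M t (flow F M s x) = flow F M (s + t) x"
proof -
  let ?E = "existence_interval F M"
  have shift: "t \<in> ?E (flow F M s x) \<and> flow F M t (flow F M s x) = flow F M (s + t) x"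
    if "x \<in> M" "s \<in> ?E x" "s + t \<in> ?E x" for x s t
  proof -
    have "ode_solution F M (flow F M s x) {t. s + t \<in> ?E x} (\<lambda>t. flow F M (s + t) x)"
      using ode_solution_shift[OF maximal_solution[OF wp that(1)] that(2)] .
    then show ?thesis
      using that flow_eq_solution[OF wp flow_mem[OF wp that(1,2)]] mem_existence_intervalI
      by fastforce
  qed
  show "s + t \<in> ?E x \<Longrightarrow> flow F M t (flow F M s x) = flow F M (s + t) x"
    using shift[OF x s] by blast
  have return: "- s \<in> ?E (flow F M s x)" "flow F M (- s) (flow F M s x) = x"
    using shift[OF x s, of "- s"] zero_mem_existence_interval[OF wp x] flow_0[OF wp x] by auto
  show "t \<in> ?E (flow F M s x) \<longleftrightarrow> s + t \<in> ?E x"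
    using shift[OF x s, of t] shift[OF flow_mem[OF wp x s] return(1), of "s + t"] return(2) by auto
qed

lemma flow_uminus:
  assumes "well_posed F M" "x \<in> M" "t \<in> existence_interval F M x"
  shows "- t \<in> existence_interval F M (flow F M t x)" and "flow F M (- t) (flow F M t x) = x"
  using existence_interval_flow[OF assms, of "- t"] flow_add[OF assms, of "- t"]
    zero_mem_existence_interval[OF assms(1,2)] assms(1,2) by auto

section \<open>The time of flight\<close>

text \<open>Two flight times \<open>r \<noteq> r'\<close> would give an orbit that returns to \<open>\<Lambda>\<close>: the foot point for \<open>r\<close> flows
  to the foot point for \<open>r'\<close> in time \<open>r - r'\<close>.\<close>

lemma is_flight_time_unique:
  assumes wp: "well_posed F M" and x: "x \<in> M"
    and noret: "\<And>y t. y \<in> \<Lambda> \<Longrightarrow> t \<in> existence_interval F M y \<Longrightarrow> t \<noteq> 0 \<Longrightarrow> flow F M t y \<notin> \<Lambda>"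
    and r: "is_flight_time F M \<Lambda> t1 t2 x r" and r': "is_flight_time F M \<Lambda> t1 t2 x r'"
  shows "r = r'"
proof (rule ccontr)
  assume "r \<noteq> r'"
  let ?y = "flow F M (- r) x"
  have y: "- r \<in> existence_interval F M x" "?y \<in> \<Lambda>"
    and y': "- r' \<in> existence_interval F M x" "flow F M (- r') x \<in> \<Lambda>"
    using r r' by (auto simp: is_flight_time_def)
  have "r - r' \<in> existence_interval F M ?y" "flow F M (r - r') ?y \<in> \<Lambda>"
    using existence_interval_flow[OF wp x y(1), of "r - r'"] flow_add[OF wp x y(1), of "r - r'"] y'
    by auto
  then show False
    using noret[OF y(2)] \<open>r \<noteq> r'\<close> by auto
qed

lemma is_flight_time_flow:
  assumes "well_posed F M" "\<Lambda> \<subseteq> M" "y \<in> \<Lambda>" "r \<in> {t1..t2}" "r \<in> existence_interval F M y"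
  shows "is_flight_time F M \<Lambda> t1 t2 (flow F M r y) r"
  using assms flow_uminus[of F M y r] by (auto simp: is_flight_time_def)

lemma r_star_eqI:
  assumes "well_posed F M" "x \<in> M"
    and "\<And>y t. y \<in> \<Lambda> \<Longrightarrow> t \<in> existence_interval F M y \<Longrightarrow> t \<noteq> 0 \<Longrightarrow> flow F M t y \<notin> \<Lambda>"
    and "is_flight_time F M \<Lambda> t1 t2 x r"
  shows "r_star F M \<Lambda> t1 t2 x = r"
  unfolding r_star_def
proof (rule the_equality)
  show "r' = r" if "is_flight_time F M \<Lambda> t1 t2 x r'" for r'
    by (rule is_flight_time_unique[OF assms(1-3) that assms(4)])
qed (rule assms(4))

section \<open>The eigenfunction equation as a differential equation\<close>

lemma open_KEIGS_D:
  assumes "open_KEIGS F M U lam \<phi>" "x \<in> U" "t \<in> existence_interval F M x" "flow F M t x \<in> U"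
  shows "\<phi> (flow F M t x) = exp (lam * of_real t) * \<phi> x"
  using assms by (simp add: open_KEIGS_def koopman_def)

text \<open>Both sides of \<open>\<phi> (\<rho>\<^sub>t x) = e\<^bsup>\<lambda>t\<^esup> \<phi> x\<close> are differentiated at \<open>t = 0\<close>. As \<open>x\<close> is interior to
  \<open>U\<close>, the orbit stays in \<open>U\<close> for short times; as the existence interval is not just \<open>{0}\<close>, the
  derivative within it, possibly one-sided, is unique.\<close>

lemma open_KEIGS_imp_koopman_pde_at:
  assumes wp: "well_posed F M" and xM: "x \<in> M" and K: "open_KEIGS F M U lam \<phi>"
    and x: "x \<in> interior U" and diff: "\<phi> differentiable (at x)"
  shows "koopman_pde_at F lam \<phi> x"
proof -
  obtain D where D: "(\<phi> has_derivative D) (at x)"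
    using diff by (auto simp: differentiable_def)
  obtain I u where sol: "ode_solution F M x I u" and "I \<noteq> {0}"
    using wp xM unfolding well_posed_def by blast
  have I: "is_interval I" "0 \<in> I" and u0: "u 0 = x"
    and du: "(u has_vector_derivative F x) (at 0 within I)"
    using sol by (auto simp: ode_solution_def)
  have nontriv: "at 0 within I \<noteq> bot"
  proof -
    obtain c where "c \<in> I" "c \<noteq> 0" using I \<open>I \<noteq> {0}\<close> by blast
    then have "0 islimpt I"
      using I by (intro connected_imp_perfect) (auto simp: is_interval_connected)
    then show ?thesis by (simp add: trivial_limit_within)
  qed
  have lhs: "((\<phi> \<circ> u) has_vector_derivative D (F x)) (at 0 within I)"
  proof (rule vector_derivative_diff_chain_within[OF du])
    show "(\<phi> has_derivative D) (at (u 0) within u ` I)"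
      using D u0 by (simp add: has_derivative_at_withinI)
  qed
  have rhs: "((\<lambda>t. exp (lam * of_real t) * \<phi> x) has_vector_derivative lam * \<phi> x) (at 0 within I)"
  proof (rule has_vector_derivative_eq_rhs)
    show "((\<lambda>t. exp (lam * of_real t) * \<phi> x) has_vector_derivative
        exp (lam * of_real 0) * (lam * 1) * \<phi> x) (at 0 within I)"
      by (rule has_vector_derivative_real_field[where f="\<lambda>z. exp (lam * z) * \<phi> x"])
        (auto intro!: derivative_eq_intros)
  qed simp
  have "(u \<longlongrightarrow> x) (at 0 within I)"
    using has_vector_derivative_continuous[OF du] u0 by (simp add: continuous_within)
  then have "\<forall>\<^sub>F t in at 0 within I. u t \<in> interior U"
    using x by (intro topological_tendstoD) auto
  moreover have "\<forall>\<^sub>F t in at 0 within I. t \<in> I"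
    by (simp add: eventually_at_filter)
  ultimately have "\<forall>\<^sub>F t in at 0 within I. (\<phi> \<circ> u) t = exp (lam * of_real t) * \<phi> x"
  proof eventually_elim
    case (elim t)
    then have "flow F M t x = u t" "t \<in> existence_interval F M x"
      using flow_eq_solution[OF wp xM sol] mem_existence_intervalI[OF sol] by auto
    then show ?case
      using open_KEIGS_D[OF K, of x t] elim x subsetD[OF interior_subset[of U]] by auto
  qed
  with lhs have "((\<lambda>t. exp (lam * of_real t) * \<phi> x) has_vector_derivative D (F x)) (at 0 within I)"
    unfolding has_vector_derivative_def
    by (rule has_derivative_transform_eventually) (use u0 I in auto)
  then have "D (F x) = lam * \<phi> x"
    using vector_derivative_unique_within[OF nontriv] rhs by blast
  then show ?thesis
    using D by (auto simp: koopman_pde_at_def)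
qed

section \<open>The form of the open eigenfunctions\<close>

theorem theorem2:
  fixes F :: "real ^ 'n \<Rightarrow> real ^ 'n"
    and M \<Lambda> U :: "(real ^ 'n) set"
    and t1 t2 :: real
    and h :: "real ^ 'n \<Rightarrow> complex"
    and s :: "real ^ 'n \<Rightarrow> 'p"
    and lam :: complex
  assumes "well_posed F M"
    and "\<Lambda> \<subseteq> M"
    and "closedin (top_of_set M) \<Lambda>"
    and "C1_hypersurface \<Lambda>"
    and "transverse F \<Lambda>"
    and "t1 \<le> 0" and "0 \<le> t2"
    and "\<And>y. y \<in> \<Lambda> \<Longrightarrow> {t1..t2} \<subseteq> existence_interval F M y"
    and "nonrecurrent F M \<Lambda> t1 t2"
    and "U = flow_domain F M \<Lambda> t1 t2"
    and "C1_on_hypersurface \<Lambda> h"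
    and "inj_on s \<Lambda>"
  shows "(\<forall>x\<in>U. \<exists>!r. is_flight_time F M \<Lambda> t1 t2 x r) \<and>
    (\<forall>\<phi>. open_KEIGS F M U lam \<phi> \<and> (\<forall>y\<in>\<Lambda>. \<phi> y = h y) \<longleftrightarrow>
       (\<forall>x\<in>U. \<phi> x = (in_parameter s \<Lambda> h \<circ> s_star F M \<Lambda> t1 t2 s) x *
                      exp (lam * of_real (r_star F M \<Lambda> t1 t2 x)))) \<and>
    (\<forall>\<phi>. open_KEIGS F M U lam \<phi> \<and> (\<forall>y\<in>\<Lambda>. \<phi> y = h y) \<longrightarrow>
       (\<forall>x\<in>interior U. \<phi> differentiable (at x) \<longrightarrow> koopman_pde_at F lam \<phi> x))"
proof -
  note wp = assms(1) and sub = assms(2) and t1 = assms(6) and t2 = assms(7) and ex = assms(8)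
  have noret: "flow F M t y \<notin> \<Lambda>" if "y \<in> \<Lambda>" "t \<in> existence_interval F M y" "t \<noteq> 0" for y t
    using assms(9) that by (auto simp: nonrecurrent_def Let_def)
  let ?r = "r_star F M \<Lambda> t1 t2"
  let ?foot = "\<lambda>x. flow F M (- ?r x) x"
  have U_iff: "x \<in> U \<longleftrightarrow> (\<exists>t\<in>{t1..t2}. \<exists>y\<in>\<Lambda>. x = flow F M t y)" for x
    using assms(10) by (auto simp: flow_domain_def)
  have UM: "U \<subseteq> M"
  proof
    fix x assume "x \<in> U"
    then obtain t y where "t \<in> {t1..t2}" "y \<in> \<Lambda>" "x = flow F M t y"
      using U_iff by blast
    then show "x \<in> M"
      using flow_mem[OF wp, of y t] ex[of y] sub by blast
  qed
  have flight: "\<exists>!r. is_flight_time F M \<Lambda> t1 t2 x r" if x: "x \<in> U" for x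
  proof (rule ex_ex1I)
    obtain t y where "t \<in> {t1..t2}" "y \<in> \<Lambda>" "x = flow F M t y"
      using x U_iff by blast
    then show "\<exists>r. is_flight_time F M \<Lambda> t1 t2 x r"
      using is_flight_time_flow[OF wp sub, of y t t1 t2] ex[of y] by blast
    show "r = r'" if "is_flight_time F M \<Lambda> t1 t2 x r" "is_flight_time F M \<Lambda> t1 t2 x r'" for r r'
      using is_flight_time_unique[OF wp _ noret that] x UM by blast
  qed
  have r_star: "is_flight_time F M \<Lambda> t1 t2 x (?r x)" if "x \<in> U" for x
    using theI'[OF flight[OF that]] by (simp add: r_star_def)
  have \<Lambda>U: "y \<in> U" and r_\<Lambda>: "?r y = 0" if y: "y \<in> \<Lambda>" for y
  proof -
    have yM: "y \<in> M" using y sub by blast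
    have "is_flight_time F M \<Lambda> t1 t2 y 0"
      using y yM t1 t2 wp zero_mem_existence_interval[OF wp yM] by (simp add: is_flight_time_def)
    then show "?r y = 0"
      using r_star_eqI[OF wp yM noret] by blast
    show "y \<in> U"
      using y yM t1 t2 wp U_iff by (metis atLeastAtMost_iff flow_0)
  qed
  have foot: "?foot x \<in> \<Lambda>" "?r x \<in> existence_interval F M (?foot x)" "flow F M (?r x) (?foot x) = x"
    if x: "x \<in> U" for x
    using r_star[OF x] flow_uminus[OF wp, of x "- ?r x"] x UM by (auto simp: is_flight_time_def)
  have param: "(in_parameter s \<Lambda> h \<circ> s_star F M \<Lambda> t1 t2 s) x = h (?foot x)" if "x \<in> U" for x
    using the_inv_into_f_f[OF assms(12) foot(1)[OF that]]
    by (simp add: in_parameter_def s_star_def)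
  \<comment> \<open>The foot points of \<open>x\<close> and of \<open>\<rho>\<^sub>t x\<close> lie on one orbit, so they coincide: otherwise \<open>\<Lambda>\<close> would
    be met twice. The flow time \<open>?d\<close> between them is then 0.\<close>
  have along: "?r (flow F M t x) = t + ?r x \<and> ?foot (flow F M t x) = ?foot x"
    if x: "x \<in> U" and t: "t \<in> existence_interval F M x" and x': "flow F M t x \<in> U" for x t
  proof -
    let ?x' = "flow F M t x"
    have xM: "x \<in> M" using x UM by blast
    have E: "t - ?r ?x' \<in> existence_interval F M x" "- ?r x \<in> existence_interval F M x"
      and foot': "?foot ?x' = flow F M (t - ?r ?x') x"
      using r_star[OF x] r_star[OF x'] existence_interval_flow[OF wp xM t, of "- ?r ?x'"]
        flow_add[OF wp xM t, of "- ?r ?x'"]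
      by (auto simp: is_flight_time_def)
    let ?d = "t + ?r x - ?r ?x'"
    have d: "?d \<in> existence_interval F M (?foot x)" "flow F M ?d (?foot x) = ?foot ?x'"
      using existence_interval_flow[OF wp xM E(2), of ?d] flow_add[OF wp xM E(2), of ?d] E(1) foot'
      by (auto simp: algebra_simps)
    then have "?d = 0"
      using noret[OF foot(1)[OF x] d(1)] foot(1)[OF x'] by auto
    then show ?thesis using d(2) wp sub foot(1)[OF x] by auto
  qed
  have char: "open_KEIGS F M U lam \<phi> \<and> (\<forall>y\<in>\<Lambda>. \<phi> y = h y) \<longleftrightarrow>
      (\<forall>x\<in>U. \<phi> x = h (?foot x) * exp (lam * of_real (?r x)))" (is "?eig \<longleftrightarrow> ?form") for \<phi>
  proof
    assume eig: ?eig
    show ?form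
    proof
      fix x assume x: "x \<in> U"
      note y = foot[OF x]
      have "\<phi> (flow F M (?r x) (?foot x)) = exp (lam * of_real (?r x)) * \<phi> (?foot x)"
        using open_KEIGS_D[OF conjunct1[OF eig] \<Lambda>U[OF y(1)] y(2)] y(3) x by simp
      then show "\<phi> x = h (?foot x) * exp (lam * of_real (?r x))"
        using eig y by simp
    qed
  next
    assume form: ?form
    have "\<phi> y = h y" if "y \<in> \<Lambda>" for y
      using form \<Lambda>U[OF that] r_\<Lambda>[OF that] that sub wp by auto
    moreover have "\<phi> (flow F M t x) = exp (lam * of_real t) * \<phi> x"
      if "x \<in> U" "t \<in> existence_interval F M x" "flow F M t x \<in> U" for x t
    proof -
      have "\<phi> (flow F M t x) = h (?foot x) * exp (lam * of_real (t + ?r x))"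
        using form that(3) along[OF that] by metis
      then show ?thesis
        using form that(1) by (simp add: distrib_left exp_add)
    qed
    ultimately show ?eig
      by (auto simp: open_KEIGS_def koopman_def)
  qed
  have pde: "koopman_pde_at F lam \<phi> x"
    if "open_KEIGS F M U lam \<phi>" "x \<in> interior U" "\<phi> differentiable (at x)" for \<phi> x
    using open_KEIGS_imp_koopman_pde_at[OF wp _ that] UM interior_subset that(2) by blast
  show ?thesis
  proof (intro conjI)
    show "\<forall>\<phi>. open_KEIGS F M U lam \<phi> \<and> (\<forall>y\<in>\<Lambda>. \<phi> y = h y) \<longleftrightarrow>
       (\<forall>x\<in>U. \<phi> x = (in_parameter s \<Lambda> h \<circ> s_star F M \<Lambda> t1 t2 s) x * exp (lam * of_real (?r x)))"
      unfolding char using param by simp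
  qed (use flight pde in blast)+
qed

end
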